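(* Let $R_1$ and $R_2$ be two finite rings such that $|Z(R_1)|=|Z(R_2)|$. If $R_1$ and $R_2$ are $\mathbb{Z}$-isoclinic, then their non-commuting graphs are isomorphic: $\Gamma_{R_1}\cong\Gamma_{R_2}$.
   Context: Rings are associative and not assumed to have a unity. For a ring $R$, $Z(R)=\{x\in R : xr=rx \text{ for all } r\in R\}$ is its center, $[u,v]=uv-vu$ for $u,v\in R$, and $[R,R]$ is the additive subgroup of $R$ generated by all $[u,v]$ with $u,v\in R$. The quotient $\frac{R}{Z(R)}$ is the quotient of additive groups. The non-commuting graph $\Gamma_R$ of a finite ring $R$ is the simple undirected graph with vertex set $R\setminus Z(R)$ in which two distinct vertices $a,b$ are adjacent if and only if $ab\neq ba$. Two rings $R_1$ and $R_2$ are $\mathbb{Z}$-isoclinic if there exist additive group isomorphisms $\phi:\frac{R_1}{Z(R_1)}\to\frac{R_2}{Z(R_2)}$ and $\psi:[R_1,R_1]\to[R_2,R_2]$ such that $\psi([u,v])=[u',v']$ whenever $\phi(u+Z(R_1))=u'+Z(R_2)$ and $\phi(v+Z(R_1))=v'+Z(R_2)$. *)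

theory Defs
  imports
    "HOL-Algebra.AbelCoset"
    "HOL-Algebra.Generated_Groups"
    "Graph_Theory.Digraph_Isomorphism"
    "Graph_Theory.Pair_Digraph"
begin

text \<open>
  Associative rings, not assumed to have a unity.  The record type of HOL-Algebra is reused;
  its field \<^const>\<open>one\<close> is unconstrained and never referred to.
\<close>

locale nonunital_ring = abelian_group R for R (structure) +
  assumes mult_closed: "\<lbrakk>x \<in> carrier R; y \<in> carrier R\<rbrakk> \<Longrightarrow> x \<otimes> y \<in> carrier R"
    and mult_assoc: "\<lbrakk>x \<in> carrier R; y \<in> carrier R; z \<in> carrier R\<rbrakk>
      \<Longrightarrow> (x \<otimes> y) \<otimes> z = x \<otimes> (y \<otimes> z)"
    and distrib_right: "\<lbrakk>x \<in> carrier R; y \<in> carrier R; z \<in> carrier R\<rbrakk>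
      \<Longrightarrow> (x \<oplus> y) \<otimes> z = x \<otimes> z \<oplus> y \<otimes> z"
    and distrib_left: "\<lbrakk>x \<in> carrier R; y \<in> carrier R; z \<in> carrier R\<rbrakk>
      \<Longrightarrow> z \<otimes> (x \<oplus> y) = z \<otimes> x \<oplus> z \<otimes> y"

definition ring_center :: "('a, 'm) ring_scheme \<Rightarrow> 'a set" where
  "ring_center R = {x \<in> carrier R. \<forall>r \<in> carrier R. x \<otimes>\<^bsub>R\<^esub> r = r \<otimes>\<^bsub>R\<^esub> x}"

definition ring_commutator :: "('a, 'm) ring_scheme \<Rightarrow> 'a \<Rightarrow> 'a \<Rightarrow> 'a" where
  "ring_commutator R u v = (u \<otimes>\<^bsub>R\<^esub> v) \<ominus>\<^bsub>R\<^esub> (v \<otimes>\<^bsub>R\<^esub> u)"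

definition commutator_subgroup :: "('a, 'm) ring_scheme \<Rightarrow> 'a set" where
  "commutator_subgroup R =
     generate (add_monoid R) {ring_commutator R u v | u v. u \<in> carrier R \<and> v \<in> carrier R}"

definition Z_isoclinic :: "('a, 'm) ring_scheme \<Rightarrow> ('b, 'n) ring_scheme \<Rightarrow> bool" where
  "Z_isoclinic R S \<longleftrightarrow>
     (\<exists>\<phi> \<psi>.
        \<phi> \<in> iso (R A_Mod ring_center R) (S A_Mod ring_center S) \<and>
        \<psi> \<in> iso ((add_monoid R)\<lparr>carrier := commutator_subgroup R\<rparr>)
                ((add_monoid S)\<lparr>carrier := commutator_subgroup S\<rparr>) \<and>
        (\<forall>u \<in> carrier R. \<forall>v \<in> carrier R. \<forall>u' \<in> carrier S. \<forall>v' \<in> carrier S.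
           \<phi> (ring_center R +>\<^bsub>R\<^esub> u) = ring_center S +>\<^bsub>S\<^esub> u' \<longrightarrow>
           \<phi> (ring_center R +>\<^bsub>R\<^esub> v) = ring_center S +>\<^bsub>S\<^esub> v' \<longrightarrow>
           \<psi> (ring_commutator R u v) = ring_commutator S u' v'))"

text \<open>
  Following the Graph_Theory library, an undirected simple graph is a loop-free symmetric
  digraph: an edge between \<open>a\<close> and \<open>b\<close> is the pair of arcs \<open>(a, b)\<close>, \<open>(b, a)\<close>.
  The lemma \<open>non_commuting_graph_pair_graph\<close> below confirms that the result is such a graph.
\<close>

definition non_commuting_graph :: "('a, 'm) ring_scheme \<Rightarrow> 'a pair_pre_digraph" where
  "non_commuting_graph R =
     \<lparr>pverts = carrier R - ring_center R,
      parcs = {(a, b). a \<in> carrier R - ring_center R \<and> b \<in> carrier R - ring_center R \<and>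
                       a \<noteq> b \<and> a \<otimes>\<^bsub>R\<^esub> b \<noteq> b \<otimes>\<^bsub>R\<^esub> a}\<rparr>"

lemma ring_imp_nonunital_ring:
  assumes "ring R"
  shows "nonunital_ring R"
proof -
  interpret ring R by fact
  show ?thesis by unfold_locales (auto simp: m_assoc l_distr r_distr)
qed

lemma non_commuting_graph_pair_graph:
  assumes "finite (carrier R)"
  shows "pair_graph (non_commuting_graph R)"
proof -
  let ?V = "carrier R - ring_center R"
  have "parcs (non_commuting_graph R) \<subseteq> ?V \<times> ?V"
    by (auto simp: non_commuting_graph_def)
  moreover have "finite (?V \<times> ?V)"
    using assms by simp
  ultimately have "finite (parcs (non_commuting_graph R))"
    by (rule finite_subset)
  then show ?thesis
    using assms by unfold_locales (auto simp: non_commuting_graph_def symmetric_def sym_def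
      arcs_ends_def arc_to_ends_def image_iff)
qed

context nonunital_ring
begin

lemma mult_zero_left: "x \<in> carrier R \<Longrightarrow> \<zero> \<otimes> x = \<zero>"
  by (metis add.r_cancel_one' distrib_right l_zero mult_closed zero_closed)

lemma mult_zero_right: "x \<in> carrier R \<Longrightarrow> x \<otimes> \<zero> = \<zero>"
  by (metis add.r_cancel_one' distrib_left l_zero mult_closed zero_closed)

lemma mult_minus_left:
  assumes "x \<in> carrier R" "y \<in> carrier R"
  shows "(\<ominus> x) \<otimes> y = \<ominus> (x \<otimes> y)"
  using assms
  by (metis a_inv_closed distrib_right l_neg minus_equality mult_closed mult_zero_left)

lemma mult_minus_right:
  assumes "x \<in> carrier R" "y \<in> carrier R"
  shows "y \<otimes> (\<ominus> x) = \<ominus> (y \<otimes> x)"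
  using assms
  by (metis a_inv_closed distrib_left l_neg minus_equality mult_closed mult_zero_right)

lemma ring_center_normal: "ring_center R \<lhd> add_monoid R"
proof (rule comm_group.subgroup_imp_normal[OF a_comm_group])
  show "subgroup (ring_center R) (add_monoid R)"
  proof (rule add.subgroupI)
    show "ring_center R \<noteq> {}"
      using mult_zero_left mult_zero_right by (auto simp: ring_center_def)
  qed (auto simp: ring_center_def distrib_left distrib_right mult_minus_left mult_minus_right
         simp flip: a_inv_def)
qed

end

text \<open>
  Graph_Theory's \<^const>\<open>digraph_iso\<close> speaks about vertex maps together with arc maps; for
  graphs whose arcs are pairs of vertices it is the usual notion.
\<close>

lemma digraph_iso_with_proj_iff:
  assumes "pair_wf_digraph G" "pair_wf_digraph H"
  shows "digraph_iso (with_proj G) (with_proj H) \<longleftrightarrow>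
    (\<exists>f. bij_betw f (pverts G) (pverts H) \<and>
      (\<forall>a \<in> pverts G. \<forall>b \<in> pverts G. (a, b) \<in> parcs G \<longleftrightarrow> (f a, f b) \<in> parcs H))"
  (is "?L \<longleftrightarrow> ?R")
proof
  interpret G: pair_wf_digraph G by fact
  interpret H: pair_wf_digraph H by fact
  {
    assume ?L
    then obtain h where h: "G.digraph_isomorphism h" and H: "with_proj H = app_iso h (with_proj G)"
      unfolding digraph_iso_def by blast
    have V: "pverts H = iso_verts h ` pverts G" and A: "parcs H = iso_arcs h ` parcs G"
      and "fst = iso_tail h" "snd = iso_head h"
      using H by (auto simp: with_proj_def app_iso_def)
    with h have inj: "inj_on (iso_verts h) (pverts G)"
      and ends: "\<And>e. e \<in> parcs G \<Longrightarrow> iso_arcs h e = (iso_verts h (fst e), iso_verts h (snd e))"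
      by (auto simp: G.digraph_isomorphism_def prod_eq_iff)
    have A': "parcs H = (\<lambda>e. (iso_verts h (fst e), iso_verts h (snd e))) ` parcs G"
      unfolding A by (rule image_cong[OF refl ends])
    have "(a, b) \<in> parcs G \<longleftrightarrow> (iso_verts h a, iso_verts h b) \<in> parcs H"
      if "a \<in> pverts G" "b \<in> pverts G" for a b
      using that inj unfolding A'
      by (auto simp: image_iff dest: inj_onD G.arc_fst_in_verts G.arc_snd_in_verts
            intro!: bexI[of _ "(a, b)"])
         (metis G.arc_fst_in_verts G.arc_snd_in_verts fst_conv inj_onD snd_conv)
    with inj V show ?R
      by (intro exI[of _ "iso_verts h"]) (auto simp: bij_betw_def)
  }
  {
    assume ?R
    then obtain f where f: "bij_betw f (pverts G) (pverts H)"
      and e: "\<And>a b. a \<in> pverts G \<Longrightarrow> b \<in> pverts G \<Longrightarrow>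
                (a, b) \<in> parcs G \<longleftrightarrow> (f a, f b) \<in> parcs H"
      by blast
    let ?h = "\<lparr>iso_verts = f, iso_arcs = map_prod f f, iso_head = snd, iso_tail = fst\<rparr>"
    have inj: "inj_on f (pverts G)" and V: "f ` pverts G = pverts H"
      using f by (auto simp: bij_betw_def)
    have sub: "parcs G \<subseteq> pverts G \<times> pverts G"
      using G.arc_fst_in_verts G.arc_snd_in_verts by fastforce
    have "inj_on (map_prod f f) (parcs G)"
      using map_prod_inj_on[OF inj inj] sub by (rule inj_on_subset)
    then have "G.digraph_isomorphism ?h"
      using inj by (auto simp: G.digraph_isomorphism_def G.wf_digraph)
    moreover have "parcs H = map_prod f f ` parcs G"
    proof (intro equalityI subsetI)
      fix p assume p: "p \<in> parcs H"
      then have "fst p \<in> f ` pverts G" "snd p \<in> f ` pverts G"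
        using H.arc_fst_in_verts H.arc_snd_in_verts V by auto
      then obtain a b where "a \<in> pverts G" "b \<in> pverts G" "p = (f a, f b)"
        by (metis imageE prod.collapse)
      with e p show "p \<in> map_prod f f ` parcs G"
        by (metis image_eqI map_prod_simp)
    qed (use sub e in auto)
    ultimately show ?L
      using V unfolding digraph_iso_def
      by (intro exI[of _ ?h]) (auto simp: app_iso_def with_proj_def)
  }
qed

end

theory Submission
  imports Defs
begin

text \<open>
  A \<open>\<int>\<close>-isoclinism relates elements only up to the center, while an isomorphism of graphs has to
  be a map on elements.  The gap is one of counting: all cosets of the center have the size of the
  center, so when the two centers are equally large, the bijection \<open>\<phi>\<close> between the sets of cosets
  lifts, coset by coset, to a bijection \<open>f\<close> between the rings (lemma \<open>bij_betw_lift_fibres\<close>).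
  Any such lift \<open>f\<close> preserves and reflects commutation.  Indeed \<open>\<psi>\<close> sends \<open>[u, v]\<close> to
  \<open>[f u, f v]\<close> and is injective, and \<open>u\<close>, \<open>v\<close> commute exactly when \<open>[u, v] = [u, u]\<close>
  (lemma \<open>Z_isoclinic_imp_commutation_bij\<close>).  Finally, center and non-commuting graph are
  defined by commutation alone, so \<open>f\<close> restricts to an isomorphism of the graphs.
\<close>

text \<open>
  The lift is glued from arbitrary bijections between corresponding fibres, which exist because
  these are finite sets of equal size.
\<close>

lemma bij_betw_lift_fibres:
  assumes "finite A" "finite B"
    and \<phi>: "bij_betw \<phi> (\<pi> ` A) (\<rho> ` B)"
    and card: "\<And>c. c \<in> \<pi> ` A \<Longrightarrow> card {x \<in> A. \<pi> x = c} = card {y \<in> B. \<rho> y = \<phi> c}"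
  obtains f where "bij_betw f A B" "\<And>x. x \<in> A \<Longrightarrow> \<rho> (f x) = \<phi> (\<pi> x)"
proof -
  have "\<exists>g. bij_betw g {x \<in> A. \<pi> x = c} {y \<in> B. \<rho> y = \<phi> c}" if "c \<in> \<pi> ` A" for c
    using assms(1,2) card[OF that] by (intro finite_same_card_bij) auto
  then obtain g where
    g: "\<And>c. c \<in> \<pi> ` A \<Longrightarrow> bij_betw (g c) {x \<in> A. \<pi> x = c} {y \<in> B. \<rho> y = \<phi> c}"
    by metis
  define f where "f x = g (\<pi> x) x" for x
  have f: "f x \<in> B" "\<rho> (f x) = \<phi> (\<pi> x)" if "x \<in> A" for x
    using bij_betwE[OF g, of "\<pi> x"] that by (auto simp: f_def)
  have "inj_on f A"
  proof (rule inj_onI)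
    fix x y assume xy: "x \<in> A" "y \<in> A" "f x = f y"
    then have "\<phi> (\<pi> x) = \<phi> (\<pi> y)"
      using f(2) by metis
    with xy \<phi> have "\<pi> x = \<pi> y"
      by (auto simp: bij_betw_def dest: inj_onD)
    with xy g[of "\<pi> x"] show "x = y"
      by (auto simp: bij_betw_def f_def dest: inj_onD)
  qed
  moreover have "B \<subseteq> f ` A"
  proof
    fix y assume y: "y \<in> B"
    then obtain c where c: "c \<in> \<pi> ` A" "\<rho> y = \<phi> c"
      using bij_betw_imp_surj_on[OF \<phi>] by blast
    with y have "y \<in> g c ` {x \<in> A. \<pi> x = c}"
      using bij_betw_imp_surj_on[OF g[OF c(1)]] by simp
    then show "y \<in> f ` A"
      by (auto simp: f_def)
  qed
  ultimately have "bij_betw f A B"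
    using f(1) by (auto simp: bij_betw_def)
  with f(2) that show thesis
    by blast
qed

context nonunital_ring
begin

lemma abelian_subgroup_ring_center: "abelian_subgroup (ring_center R) R"
  by (intro abelian_subgroupI3 additive_subgroup.intro normal_imp_subgroup
      ring_center_normal abelian_group_axioms)

text \<open>
  The fibre of the projection \<open>R \<rightarrow> R / Z(R)\<close> over a coset is that coset, a translate of the center.
\<close>

lemma card_fibre_ring_center_coset:
  assumes "a \<in> carrier R"
  shows "card {x \<in> carrier R. ring_center R +> x = ring_center R +> a} = card (ring_center R)"
proof -
  interpret Z: abelian_subgroup "ring_center R" R
    by (rule abelian_subgroup_ring_center)
  have "{x \<in> carrier R. ring_center R +> x = ring_center R +> a} = ring_center R +> a"
    using assms
    by (blast dest: Z.a_repr_independenceD Z.a_repr_independence' Z.a_elemrcos_carrier)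
  moreover have "ring_center R +> a \<in> a_rcosets (ring_center R)"
    using assms by (simp add: a_rcosetsI Z.a_subset)
  then have "card (ring_center R +> a) = card (ring_center R)"
    unfolding A_RCOSETS_def by (rule add.card_rcosets_equal[OF _ Z.a_subset, symmetric])
  ultimately show ?thesis
    by simp
qed

lemma ring_commutator_self: "u \<in> carrier R \<Longrightarrow> ring_commutator R u u = \<zero>"
  by (simp add: ring_commutator_def mult_closed a_minus_def r_neg)

lemma ring_commutator_eq_zero_iff:
  assumes "u \<in> carrier R" "v \<in> carrier R"
  shows "ring_commutator R u v = \<zero> \<longleftrightarrow> u \<otimes> v = v \<otimes> u"
proof
  assume "ring_commutator R u v = \<zero>"
  with assms have "\<ominus> (\<ominus> (v \<otimes> u)) = u \<otimes> v"
    by (intro minus_equality) (simp_all add: ring_commutator_def mult_closed a_minus_def)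
  with assms show "u \<otimes> v = v \<otimes> u"
    by (simp add: mult_closed)
qed (use assms in \<open>simp add: ring_commutator_def mult_closed a_minus_def r_neg\<close>)

lemma ring_commutator_in_commutator_subgroup:
  assumes "u \<in> carrier R" "v \<in> carrier R"
  shows "ring_commutator R u v \<in> commutator_subgroup R"
  using assms unfolding commutator_subgroup_def by (blast intro: generate.incl)

end

text \<open>
  Two elements commute exactly when their commutator vanishes, and zero can be written as
  \<open>[u, u]\<close>; this form is what the compatibility of \<open>\<phi>\<close> and \<open>\<psi>\<close> transports directly.
\<close>

lemma Z_isoclinic_imp_commutation_bij:
  fixes R :: "('a, 'm) ring_scheme" and S :: "('b, 'n) ring_scheme"
  assumes "nonunital_ring R" "finite (carrier R)" "nonunital_ring S" "finite (carrier S)"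
    and card: "card (ring_center R) = card (ring_center S)"
    and "Z_isoclinic R S"
  obtains f where "bij_betw f (carrier R) (carrier S)"
    and "\<And>u v. u \<in> carrier R \<Longrightarrow> v \<in> carrier R \<Longrightarrow>
      u \<otimes>\<^bsub>R\<^esub> v = v \<otimes>\<^bsub>R\<^esub> u \<longleftrightarrow> f u \<otimes>\<^bsub>S\<^esub> f v = f v \<otimes>\<^bsub>S\<^esub> f u"
proof -
  interpret R: nonunital_ring R by fact
  interpret S: nonunital_ring S by fact
  let ?\<pi> = "\<lambda>x. ring_center R +>\<^bsub>R\<^esub> x" and ?\<rho> = "\<lambda>y. ring_center S +>\<^bsub>S\<^esub> y"
  obtain \<phi> \<psi> where
    "\<phi> \<in> iso (R A_Mod ring_center R) (S A_Mod ring_center S)" and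
    \<psi>: "\<psi> \<in> iso ((add_monoid R)\<lparr>carrier := commutator_subgroup R\<rparr>)
               ((add_monoid S)\<lparr>carrier := commutator_subgroup S\<rparr>)" and
    compat: "\<And>u v u' v'. \<lbrakk>u \<in> carrier R; v \<in> carrier R; u' \<in> carrier S; v' \<in> carrier S;
        \<phi> (?\<pi> u) = ?\<rho> u'; \<phi> (?\<pi> v) = ?\<rho> v'\<rbrakk>
      \<Longrightarrow> \<psi> (ring_commutator R u v) = ring_commutator S u' v'"
    using assms(6) unfolding Z_isoclinic_def by blast
  then have \<phi>: "bij_betw \<phi> (?\<pi> ` carrier R) (?\<rho> ` carrier S)"
    by (simp add: iso_def A_FactGroup_def' A_RCOSETS_def' UNION_singleton_eq_range)
  have inj: "inj_on \<psi> (commutator_subgroup R)"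
    using \<psi> by (simp add: iso_def bij_betw_def)
  have fibres: "card {x \<in> carrier R. ?\<pi> x = c} = card {y \<in> carrier S. ?\<rho> y = \<phi> c}"
    if c: "c \<in> ?\<pi> ` carrier R" for c
  proof -
    obtain a where a: "a \<in> carrier R" "c = ?\<pi> a"
      using c by auto
    have "\<phi> c \<in> ?\<rho> ` carrier S"
      using bij_betwE[OF \<phi>] c by (rule bspec)
    then obtain b where b: "b \<in> carrier S" "\<phi> c = ?\<rho> b"
      by auto
    show ?thesis
      unfolding b(2) unfolding a(2)
      by (simp only: R.card_fibre_ring_center_coset[OF a(1)]
          S.card_fibre_ring_center_coset[OF b(1)] card)
  qed
  obtain f where f: "bij_betw f (carrier R) (carrier S)"
    and lift: "\<And>x. x \<in> carrier R \<Longrightarrow> ?\<rho> (f x) = \<phi> (?\<pi> x)"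
    using bij_betw_lift_fibres[OF assms(2,4) \<phi> fibres] by blast
  have "u \<otimes>\<^bsub>R\<^esub> v = v \<otimes>\<^bsub>R\<^esub> u \<longleftrightarrow> f u \<otimes>\<^bsub>S\<^esub> f v = f v \<otimes>\<^bsub>S\<^esub> f u"
    if uv: "u \<in> carrier R" "v \<in> carrier R" for u v
  proof -
    have fuv: "f u \<in> carrier S" "f v \<in> carrier S"
      using f uv by (auto dest: bij_betwE)
    have "u \<otimes>\<^bsub>R\<^esub> v = v \<otimes>\<^bsub>R\<^esub> u \<longleftrightarrow> ring_commutator R u v = ring_commutator R u u"
      using uv by (simp add: R.ring_commutator_eq_zero_iff R.ring_commutator_self)
    also have "\<dots> \<longleftrightarrow> \<psi> (ring_commutator R u v) = \<psi> (ring_commutator R u u)"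
      using uv by (simp add: inj_on_eq_iff[OF inj] R.ring_commutator_in_commutator_subgroup)
    also have "\<dots> \<longleftrightarrow> ring_commutator S (f u) (f v) = ring_commutator S (f u) (f u)"
      using uv fuv compat lift by metis
    also have "\<dots> \<longleftrightarrow> f u \<otimes>\<^bsub>S\<^esub> f v = f v \<otimes>\<^bsub>S\<^esub> f u"
      using fuv by (simp add: S.ring_commutator_eq_zero_iff S.ring_commutator_self)
    finally show ?thesis .
  qed
  with f that show thesis
    by blast
qed

theorem theorem4p1:
  fixes R1 :: "('a, 'm) ring_scheme" and R2 :: "('b, 'n) ring_scheme"
  assumes "nonunital_ring R1" and "finite (carrier R1)"
    and "nonunital_ring R2" and "finite (carrier R2)"
    and "card (ring_center R1) = card (ring_center R2)"
    and "Z_isoclinic R1 R2"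
  shows "digraph_iso (with_proj (non_commuting_graph R1)) (with_proj (non_commuting_graph R2))"
proof -
  obtain f where f: "bij_betw f (carrier R1) (carrier R2)"
    and comm: "\<And>u v. u \<in> carrier R1 \<Longrightarrow> v \<in> carrier R1 \<Longrightarrow>
      u \<otimes>\<^bsub>R1\<^esub> v = v \<otimes>\<^bsub>R1\<^esub> u \<longleftrightarrow> f u \<otimes>\<^bsub>R2\<^esub> f v = f v \<otimes>\<^bsub>R2\<^esub> f u"
    using Z_isoclinic_imp_commutation_bij[OF assms] by blast
  have inj: "inj_on f (carrier R1)" and im: "f ` carrier R1 = carrier R2"
    using f by (auto simp: bij_betw_def)
  \<comment> \<open>Surjectivity of \<open>f\<close> matters here: being central is a condition on all elements of \<open>R2\<close>.\<close>
  have center: "f x \<in> ring_center R2 \<longleftrightarrow> x \<in> ring_center R1" if "x \<in> carrier R1" for x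
    using that comm unfolding ring_center_def im[symmetric] by auto
  have "f ` (carrier R1 - ring_center R1) = carrier R2 - ring_center R2"
    using center unfolding im[symmetric] by blast
  then have bij: "bij_betw f (carrier R1 - ring_center R1) (carrier R2 - ring_center R2)"
    using inj by (auto simp: bij_betw_def intro: inj_on_subset)
  interpret G1: pair_graph "non_commuting_graph R1"
    using assms(2) by (rule non_commuting_graph_pair_graph)
  interpret G2: pair_graph "non_commuting_graph R2"
    using assms(4) by (rule non_commuting_graph_pair_graph)
  have "(a, b) \<in> parcs (non_commuting_graph R1) \<longleftrightarrow> (f a, f b) \<in> parcs (non_commuting_graph R2)"
    if "a \<in> carrier R1 - ring_center R1" "b \<in> carrier R1 - ring_center R1" for a b
    using that comm[of a b] bij_betwE[OF bij] inj_on_eq_iff[OF inj, of a b]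
    by (auto simp: non_commuting_graph_def)
  with bij show ?thesis
    unfolding digraph_iso_with_proj_iff[OF G1.pair_wf_digraph_axioms G2.pair_wf_digraph_axioms]
    by (intro exI[of _ f]) (simp add: non_commuting_graph_def)
qed

end
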